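(* Let $S$ be a nonempty (possibly infinite) set of positive integers, let $\sigma$ be a positive integer, and let $n\ge 0$ be an integer. If $\sigma\not\in S$, then $$B_{n,S\cup \{\sigma\}}=\sum_{i=0}^{\left \lfloor{n/\sigma}\right \rfloor } \frac{n!}{i!\,(n-\sigma i)!\,(\sigma!)^i} B_{n-\sigma i,S}. $$ If $\sigma \in S$, then $$B_{n,S\setminus\{\sigma\}}=\sum_{i=0}^{\left \lfloor{n/\sigma}\right \rfloor } \frac{n!\, (-1)^i}{i!\,(n-\sigma i)!\,(\sigma!)^i} B_{n-\sigma i,S}. $$
   Context: For a set $S$ of positive integers and an integer $n\ge 0$, $B_{n,S}$ is the number of set partitions of an $n$-element set into nonempty blocks all of whose sizes belong to $S$, with $B_{0,S}=1$. The same definition is used if the set is empty (so $B_{0,\emptyset}=1$ and $B_{n,\emptyset}=0$ for $n\ge1$). *)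

theory Defs
  imports Complex_Main "HOL-Library.Disjoint_Sets"
begin

(* The n-element set is fixed to be {..<n}; card_restricted_partitions below shows that
   this choice is immaterial. *)
definition restricted_partitions :: "'a set \<Rightarrow> nat set \<Rightarrow> 'a set set set" where
  "restricted_partitions A S = {P. partition_on A P \<and> (\<forall>b\<in>P. card b \<in> S)}"

definition restricted_Bell :: "nat \<Rightarrow> nat set \<Rightarrow> nat" where
  "restricted_Bell n S = card (restricted_partitions {..<n} S)"

lemma finite_restricted_partitions:
  assumes "finite A"
  shows "finite (restricted_partitions A S)"
proof (rule finite_subset)
  show "restricted_partitions A S \<subseteq> Pow (Pow A)"
    by (auto simp: restricted_partitions_def partition_on_def)
  show "finite (Pow (Pow A))" using assms by simp
qed

lemma image_restricted_partitions:
  assumes "inj_on f A" and "P \<in> restricted_partitions A S"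
  shows "(`) f ` P \<in> restricted_partitions (f ` A) S"
proof -
  have P: "partition_on A P" "\<And>b. b \<in> P \<Longrightarrow> card b \<in> S"
    using assms(2) by (auto simp: restricted_partitions_def)
  have sub: "b \<subseteq> A" if "b \<in> P" for b
    using P(1) that by (auto simp: partition_on_def)
  have "card (f ` b) = card b" if "b \<in> P" for b
    using inj_on_subset[OF assms(1) sub[OF that]] by (rule card_image)
  moreover have "partition_on (f ` A) ((`) f ` P)"
  proof (rule partition_onI)
    show "\<Union> ((`) f ` P) = f ` A" using P(1) by (auto simp: partition_on_def)
    show "{} \<notin> (`) f ` P" using P(1) by (auto simp: partition_on_def)
    show "disjnt p q" if pq: "p \<in> (`) f ` P" "q \<in> (`) f ` P" "p \<noteq> q" for p q
    proof -
      obtain b c where bc: "b \<in> P" "c \<in> P" "p = f ` b" "q = f ` c" using pq by auto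
      then have "b \<inter> c = {}"
        using pq(3) P(1) by (auto simp: partition_on_def disjoint_def)
      then have "f ` b \<inter> f ` c = {}"
        using inj_on_image_Int[OF assms(1) sub[OF bc(1)] sub[OF bc(2)]] by simp
      then show ?thesis using bc by (simp add: disjnt_def)
    qed
  qed
  ultimately show ?thesis using P(2) by (auto simp: restricted_partitions_def)
qed

lemma card_restricted_partitions_le:
  assumes "bij_betw f A B" and "finite A"
  shows "card (restricted_partitions A S) \<le> card (restricted_partitions B S)"
proof (rule card_inj_on_le)
  have inj: "inj_on f A" and B: "f ` A = B" using assms(1) by (auto simp: bij_betw_def)
  show "(`) ((`) f) ` restricted_partitions A S \<subseteq> restricted_partitions B S"
    using image_restricted_partitions[OF inj] B by auto
  show "inj_on ((`) ((`) f)) (restricted_partitions A S)"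
  proof (rule inj_on_subset)
    show "inj_on ((`) ((`) f)) (Pow (Pow A))"
      by (intro inj_on_image_Pow inj)
    show "restricted_partitions A S \<subseteq> Pow (Pow A)"
      by (auto simp: restricted_partitions_def partition_on_def)
  qed
  show "finite (restricted_partitions B S)"
    using finite_restricted_partitions assms(2) B by blast
qed

lemma card_restricted_partitions:
  assumes "finite A"
  shows "card (restricted_partitions A S) = restricted_Bell (card A) S"
proof -
  obtain h where h: "bij_betw h A {..<card A}"
    using ex_bij_betw_finite_nat[OF assms] by (auto simp: atLeast0LessThan)
  show ?thesis
    unfolding restricted_Bell_def
    using card_restricted_partitions_le[OF h assms]
      card_restricted_partitions_le[OF bij_betw_inv_into[OF h]]
    by (intro antisym) auto
qed

lemma restricted_Bell_0: "restricted_Bell 0 S = 1"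
proof -
  have "restricted_partitions {} S = {{} :: nat set set}"
    by (auto simp: restricted_partitions_def partition_on_def)
  then show ?thesis by (simp add: restricted_Bell_def)
qed

lemma restricted_Bell_empty: "n \<ge> 1 \<Longrightarrow> restricted_Bell n {} = 0"
proof -
  assume "n \<ge> 1"
  then have "(0::nat) \<in> {..<n}" by simp
  then have "restricted_partitions {..<n} {} = {}"
    by (auto simp: restricted_partitions_def partition_on_def)
  then show ?thesis by (simp add: restricted_Bell_def)
qed

end

theory Submission
  imports Defs "HOL-Computational_Algebra.Formal_Laurent_Series"
begin

unbundle fps_syntax

text \<open>
  Let \<open>E\<^sub>S\<close> be the exponential generating function of the numbers \<open>B\<^sub>n\<^sub>,\<^sub>S\<close> and let \<open>g\<^sub>S\<close> be the
  exponential generating function of \<open>S\<close>. Removing the block that contains a distinguished point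
  gives \<open>E\<^sub>S' = g\<^sub>S' E\<^sub>S\<close>. Adding or removing \<open>\<sigma>\<close> changes \<open>g\<^sub>S\<close> by \<open>c x\<^sup>\<sigma>\<close> with
  \<open>c = \<plusminus>1/\<sigma>!\<close>, so the new generating function solves the same differential equation as
  \<open>exp (c x\<^sup>\<sigma>) E\<^sub>S\<close>; by uniqueness both agree, and comparing coefficients gives both formulas.
\<close>

text \<open>Every partition of \<open>insert x A\<close> has exactly one block containing
  \<open>x\<close>. \<open>C\<close> is that block without \<open>x\<close>, so the block has size
  \<open>Suc (card C)\<close>, and the remaining blocks \<open>Q\<close> partition
  \<open>A - C\<close>.\<close>

lemma bij_betw_restricted_partitions_insert:
  assumes "finite A" and "x \<notin> A"
  shows "bij_betw (\<lambda>(C, Q). insert (insert x C) Q)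
    (SIGMA C:{C. C \<subseteq> A \<and> Suc (card C) \<in> S}. restricted_partitions (A - C) S)
    (restricted_partitions (insert x A) S)"
    (is "bij_betw ?f ?D ?R")
proof (rule bij_betw_imageI)
  have x_notin: "x \<notin> \<Union>Q" if "(C, Q) \<in> ?D" for C Q
    using that assms(2) by (auto simp: restricted_partitions_def partition_on_def)
  show "inj_on ?f ?D"
  proof (rule inj_onI)
    fix u v assume uv: "u \<in> ?D" "v \<in> ?D" "?f u = ?f v"
    obtain C Q C' Q' where u: "u = (C, Q)" and v: "v = (C', Q')" by (metis surj_pair)
    have D: "(C, Q) \<in> ?D" "(C', Q') \<in> ?D"
      and eq: "insert (insert x C) Q = insert (insert x C') Q'"
      using uv unfolding u v by simp_all
    have "x \<notin> C" "x \<notin> C'" using D assms(2) by auto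
    moreover have "insert x C = insert x C'"
    \<comment> \<open>\<open>x\<close> lies in no block of \<open>Q'\<close>, so a block of the
      common partition that contains \<open>x\<close> can only be
      \<open>insert x C'\<close>.\<close>
    proof -
      have "insert x C \<in> insert (insert x C') Q'" by (simp flip: eq)
      then show ?thesis using x_notin[OF D(2)] by auto
    qed
    ultimately have "C = C'" by (simp add: insert_ident)
    moreover have "insert x C \<notin> Q" "insert x C' \<notin> Q'"
      using x_notin[OF D(1)] x_notin[OF D(2)] by auto
    ultimately show "u = v" using eq unfolding u v by (simp add: insert_ident)
  qed
  show "?f ` ?D = ?R"
  proof (intro equalityI subsetI)
    fix P assume "P \<in> ?f ` ?D"
    then obtain C Q where D: "(C, Q) \<in> ?D" and P: "P = insert (insert x C) Q" by auto
    have C: "C \<subseteq> A" "Suc (card C) \<in> S" and Q: "partition_on (A - C) Q" "\<forall>b\<in>Q. card b \<in> S"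
      using D by (auto simp: restricted_partitions_def)
    have "insert x A - insert x C = A - C" using assms(2) by auto
    moreover have "disjnt (insert x C) (\<Union>Q)"
      using x_notin[OF D] Q(1) by (auto simp: disjnt_def partition_on_def)
    ultimately have "partition_on (insert x A) P"
      using Q(1) C(1) unfolding P by (subst partition_on_insert) auto
    moreover have "card (insert x C) = Suc (card C)"
      using C(1) assms by (intro card_insert_disjoint) (auto intro: finite_subset)
    ultimately show "P \<in> ?R" using C(2) Q(2) by (auto simp: restricted_partitions_def P)
  next
    fix P assume "P \<in> ?R"
    then have P: "partition_on (insert x A) P" "\<forall>b\<in>P. card b \<in> S"
      by (auto simp: restricted_partitions_def)
    then obtain b where b: "b \<in> P" "x \<in> b" by (auto simp: partition_on_def)
    \<comment> \<open>The inverse map: take out the block \<open>b\<close> of \<open>x\<close> and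
      delete \<open>x\<close> from it.\<close>
    define C Q where "C = b - {x}" and "Q = P - {b}"
    have b_eq: "b = insert x C" and P_eq: "P = insert b Q" using b by (auto simp: C_def Q_def)
    have "b \<subseteq> insert x A" using P(1) b(1) by (auto simp: partition_on_def)
    then have C: "C \<subseteq> A" "insert x A - b = A - C" using assms(2) by (auto simp: C_def b(2))
    have "disjnt b (\<Union>Q)"
      using P(1) b(1) by (fastforce simp: Q_def disjnt_def partition_on_def disjoint_def)
    then have "partition_on (A - C) Q"
      using P(1) C(2) unfolding P_eq by (subst (asm) partition_on_insert) auto
    moreover have "card b = Suc (card C)"
      unfolding b_eq using finite_subset[OF C(1) assms(1)] C(1) assms(2)
      by (intro card_insert_disjoint) auto
    ultimately have "(C, Q) \<in> ?D"
      using C(1) P(2) b(1) by (auto simp: restricted_partitions_def Q_def)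
    then show "P \<in> ?f ` ?D" using P_eq b_eq by (auto intro!: image_eqI[of _ _ "(C, Q)"])
  qed
qed

text \<open>Here \<open>k\<close> counts the companions of the point \<open>n\<close> in its block:
  they can be chosen in \<open>n choose k\<close> ways, and the other \<open>n - k\<close> points
  are partitioned freely with block sizes in \<open>S\<close>.\<close>

lemma restricted_Bell_Suc:
  "restricted_Bell (Suc n) S =
    (\<Sum>k\<le>n. if Suc k \<in> S then (n choose k) * restricted_Bell (n - k) S else 0)"
proof -
  let ?D = "\<lambda>k. {C. C \<subseteq> {..<n} \<and> card C = k}"
  let ?C = "{C. C \<subseteq> {..<n} \<and> Suc (card C) \<in> S}"
  have fin: "finite ?C" by (rule finite_subset[of _ "Pow {..<n}"]) auto
  have le: "card C \<le> n" if "C \<subseteq> {..<n}" for C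
    using card_mono[of "{..<n}" C] that by simp
  have "restricted_Bell (Suc n) S = card (restricted_partitions (insert n {..<n}) S)"
    by (simp add: restricted_Bell_def lessThan_Suc)
  also have "\<dots> = card (SIGMA C:?C. restricted_partitions ({..<n} - C) S)"
    using bij_betw_same_card[OF bij_betw_restricted_partitions_insert[of "{..<n}" n S]] by simp
  also have "\<dots> = (\<Sum>C\<in>?C. card (restricted_partitions ({..<n} - C) S))"
    using fin by (subst card_SigmaI) (auto intro: finite_restricted_partitions)
  also have "\<dots> = (\<Sum>C\<in>?C. restricted_Bell (n - card C) S)"
    by (intro sum.cong refl)
      (simp add: card_restricted_partitions card_Diff_subset finite_subset[of _ "{..<n}"])
  also have "\<dots> = (\<Sum>k\<le>n. \<Sum>C\<in>{C\<in>?C. card C = k}. restricted_Bell (n - card C) S)"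
    using fin le by (intro sum.group[symmetric]) auto
  also have "\<dots> = (\<Sum>k\<le>n. if Suc k \<in> S then (n choose k) * restricted_Bell (n - k) S else 0)"
  proof (intro sum.cong refl)
    fix k
    have "{C\<in>?C. card C = k} = (if Suc k \<in> S then ?D k else {})" by auto
    then show "(\<Sum>C\<in>{C\<in>?C. card C = k}. restricted_Bell (n - card C) S) =
      (if Suc k \<in> S then (n choose k) * restricted_Bell (n - k) S else 0)"
      by (simp add: n_subsets)
  qed
  finally show ?thesis .
qed

definition egf_set :: "nat set \<Rightarrow> real fps" where
  "egf_set S = Abs_fps (\<lambda>k. if k \<in> S then 1 / fact k else 0)"

definition egf_restricted_Bell :: "nat set \<Rightarrow> real fps" where
  "egf_restricted_Bell S = Abs_fps (\<lambda>n. real (restricted_Bell n S) / fact n)"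

text \<open>Dividing the recurrence by \<open>fact n\<close> turns it into a Cauchy product, since
  \<open>n choose k\<close> over \<open>fact n\<close> is \<open>1 / (fact k * fact (n - k))\<close>
  and coefficient \<open>k\<close> of \<open>fps_deriv (egf_set S)\<close> is
  \<open>1 / fact k\<close> when \<open>Suc k \<in> S\<close> and 0 otherwise.\<close>

lemma fps_deriv_egf_restricted_Bell:
  "fps_deriv (egf_restricted_Bell S) = fps_deriv (egf_set S) * egf_restricted_Bell S"
proof (rule fps_ext)
  fix n
  have "fps_deriv (egf_restricted_Bell S) $ n = real (restricted_Bell (Suc n) S) / fact n"
    by (simp add: egf_restricted_Bell_def divide_simps)
  also have "\<dots> = (\<Sum>k\<le>n. (if Suc k \<in> S then real (n choose k) * real (restricted_Bell (n - k) S) else 0) / fact n)"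
    by (simp add: restricted_Bell_Suc sum_divide_distrib if_distrib cong: if_cong)
  also have "\<dots> = (\<Sum>k\<le>n. fps_deriv (egf_set S) $ k * egf_restricted_Bell S $ (n - k))"
    by (intro sum.cong refl)
      (auto simp: egf_set_def egf_restricted_Bell_def binomial_fact divide_simps)
  finally show "fps_deriv (egf_restricted_Bell S) $ n =
      (fps_deriv (egf_set S) * egf_restricted_Bell S) $ n"
    by (simp add: fps_mult_nth atLeast0AtMost)
qed

text \<open>Coefficient \<open>m\<close> of \<open>p * f\<close> involves only coefficients of
  \<open>f\<close> up to \<open>m\<close>. In characteristic 0 one can divide by
  \<open>Suc m\<close>, so the equation determines coefficient \<open>Suc m\<close> from the earlier
  ones.\<close>

lemma fps_linear_ode_unique:
  fixes f g p :: "'a::field_char_0 fps"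
  assumes "fps_deriv f = p * f" and "fps_deriv g = p * g" and "f $ 0 = g $ 0"
  shows "f = g"
proof (rule fps_ext)
  fix n
  show "f $ n = g $ n"
  proof (induction n rule: less_induct)
    case (less n)
    show ?case
    proof (cases n)
      case 0
      then show ?thesis using assms(3) by simp
    next
      case (Suc m)
      have "(p * f) $ m = (p * g) $ m"
        unfolding fps_mult_nth using less.IH Suc by (intro sum.cong) auto
      then have "fps_deriv f $ m = fps_deriv g $ m" using assms(1,2) by simp
      then show ?thesis using Suc of_nat_neq_0[of m, where 'a='a] by simp
    qed
  qed
qed

lemma egf_restricted_Bell_perturb:
  assumes "\<sigma> > 0" and T: "egf_set T = egf_set S + fps_const c * fps_X ^ \<sigma>"
  shows "egf_restricted_Bell T = (fps_exp c oo fps_X ^ \<sigma>) * egf_restricted_Bell S"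
proof (rule fps_linear_ode_unique[OF fps_deriv_egf_restricted_Bell])
  let ?F = "fps_exp c oo fps_X ^ \<sigma>"
  \<comment> \<open>Chain rule; \<open>\<sigma> > 0\<close> gives the inner series constant term 0,
    as composition requires.\<close>
  have "fps_deriv ?F = fps_const c * fps_deriv (fps_X ^ \<sigma>) * ?F"
    using assms(1) by (simp add: fps_compose_deriv fps_compose_mult_distrib mult_ac)
  then show "fps_deriv (?F * egf_restricted_Bell S) =
      fps_deriv (egf_set T) * (?F * egf_restricted_Bell S)"
    by (simp add: T fps_deriv_egf_restricted_Bell algebra_simps)
  show "egf_restricted_Bell T $ 0 = (?F * egf_restricted_Bell S) $ 0"
    by (simp add: egf_restricted_Bell_def restricted_Bell_0)
qed

text \<open>Composition with \<open>fps_X ^ d\<close> moves coefficient \<open>i\<close> of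
  \<open>f\<close> to position \<open>d * i\<close> and leaves zeros elsewhere, so only the
  multiples \<open>k = d * i\<close> of \<open>d\<close> up to \<open>n\<close> survive in the
  Cauchy product.\<close>

lemma fps_compose_X_power_mult_nth:
  fixes f g :: "'a::idom fps"
  assumes "d > 0"
  shows "((f oo fps_X ^ d) * g) $ n = (\<Sum>i = 0..n div d. f $ i * g $ (n - d * i))"
proof -
  have "((f oo fps_X ^ d) * g) $ n = (\<Sum>k = 0..n. if d dvd k then f $ (k div d) * g $ (n - k) else 0)"
    using assms by (auto simp: fps_mult_nth fps_nth_compose_X_power intro!: sum.cong)
  also have "\<dots> = (\<Sum>k \<in> {k\<in>{0..n}. d dvd k}. f $ (k div d) * g $ (n - k))"
    by (rule sum.inter_filter[symmetric]) simp
  also have "\<dots> = (\<Sum>i = 0..n div d. f $ i * g $ (n - d * i))"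
    using assms
    by (intro sum.reindex_bij_witness[of _ "\<lambda>i. d * i" "\<lambda>k. k div d"])
      (auto simp: div_le_mono less_eq_div_iff_mult_less_eq mult.commute)
  finally show ?thesis .
qed

text \<open>Keeping \<open>c\<close> arbitrary serves both formulas at once; the factor
  \<open>c ^ i / fact i\<close> is coefficient \<open>i\<close> of \<open>fps_exp c\<close>.\<close>

lemma restricted_Bell_perturb:
  assumes "\<sigma> > 0" and "egf_set T = egf_set S + fps_const c * fps_X ^ \<sigma>"
  shows "real (restricted_Bell n T) =
    (\<Sum>i = 0..n div \<sigma>. fact n * c ^ i / (fact i * fact (n - \<sigma> * i)) * real (restricted_Bell (n - \<sigma> * i) S))"
proof -
  have "real (restricted_Bell n T) = fact n * egf_restricted_Bell T $ n"
    by (simp add: egf_restricted_Bell_def)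
  then show ?thesis
    unfolding egf_restricted_Bell_perturb[OF assms] fps_compose_X_power_mult_nth[OF assms(1)]
    by (simp add: sum_distrib_left egf_restricted_Bell_def mult_ac)
qed

theorem theorem6:
  fixes S :: "nat set" and \<sigma> n :: nat
  assumes "S \<noteq> {}" and "\<forall>s\<in>S. s > 0" and "\<sigma> > 0"
  shows "(\<sigma> \<notin> S \<longrightarrow>
            real (restricted_Bell n (S \<union> {\<sigma>})) =
              (\<Sum>i = 0..n div \<sigma>. fact n / (fact i * fact (n - \<sigma> * i) * fact \<sigma> ^ i)
                 * real (restricted_Bell (n - \<sigma> * i) S)))
       \<and> (\<sigma> \<in> S \<longrightarrow>
            real (restricted_Bell n (S - {\<sigma>})) =
              (\<Sum>i = 0..n div \<sigma>. fact n * (-1) ^ i / (fact i * fact (n - \<sigma> * i) * fact \<sigma> ^ i)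
                 * real (restricted_Bell (n - \<sigma> * i) S)))"
proof (intro conjI impI)
  assume "\<sigma> \<notin> S"
  \<comment> \<open>As \<open>\<sigma> \<notin> S\<close>, coefficient \<open>\<sigma>\<close> rises
    from 0 to \<open>1 / fact \<sigma>\<close>.\<close>
  then have "egf_set (S \<union> {\<sigma>}) = egf_set S + fps_const (1 / fact \<sigma>) * fps_X ^ \<sigma>"
    by (auto simp: fps_eq_iff egf_set_def)
  from restricted_Bell_perturb[OF assms(3) this]
  show "real (restricted_Bell n (S \<union> {\<sigma>})) =
      (\<Sum>i = 0..n div \<sigma>. fact n / (fact i * fact (n - \<sigma> * i) * fact \<sigma> ^ i)
        * real (restricted_Bell (n - \<sigma> * i) S))"
    by (simp add: power_divide mult_ac)
next
  assume "\<sigma> \<in> S"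
  \<comment> \<open>As \<open>\<sigma> \<in> S\<close>, the added term cancels coefficient
    \<open>\<sigma>\<close>; the powers of the negative constant produce the alternating
    sign.\<close>
  then have "egf_set (S - {\<sigma>}) = egf_set S + fps_const (-1 / fact \<sigma>) * fps_X ^ \<sigma>"
    by (auto simp: fps_eq_iff egf_set_def)
  from restricted_Bell_perturb[OF assms(3) this]
  show "real (restricted_Bell n (S - {\<sigma>})) =
      (\<Sum>i = 0..n div \<sigma>. fact n * (-1) ^ i / (fact i * fact (n - \<sigma> * i) * fact \<sigma> ^ i)
        * real (restricted_Bell (n - \<sigma> * i) S))"
    unfolding power_divide by (simp add: mult_ac)
qed

end
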